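(* Let $P$ be a labeled $n$-gon in $\mathbb{R}^2$ with $\operatorname{Area}(P)>0$. Suppose that the following assumptions hold. (i) All forward pentagram iterates $T^k(P)$, $k\ge 0$, are defined and $\operatorname{Area}(T^k(P))\neq 0$ for all $k\ge 0$. (ii) There exist an integer $m\ge 1$, a projectivity $G$, and a cyclic relabelling $\Sigma_s$ (with $s=0$ allowed) such that $T^m(P)=\Sigma_s(G(P))$. (iii) The projectivity $G$ has a dominant real spectral line $\ell_G$, and $\ell_G$ has a finite affine direction $u$ (i.e. $\ell_G$ is not the line at infinity and $u$ is a direction vector of its affine part). (iv) For every residue class $r=0,\ldots,m-1$, the polygon $Q^{(r)}=T^r(P)$ has an area-nondegenerate centered two-scale asymptotic under $G$ in the direction $u$. Then the area-normalized iterates $P_k=\widehat T^k(P)=(p_{k,1},\ldots,p_{k,n})$ flatten to the affine line $\mathcal L(P,G)=C(P)+\mathbb{R}u$; more precisely, as $k\to\infty$, $$\max_i\operatorname{dist}(p_{k,i},\mathcal L(P,G))\to 0\qquad\text{and}\qquad \operatorname{diam}(P_k)\to\infty .$$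
   Context: Labeled polygons: $P=(p_1,\dots,p_n)$ with $p_i\in\mathbb{R}^2$, indices modulo $n$; $\mathbb{R}^2\subset\mathbb{RP}^2$ via $x\mapsto[x:1]$. The pentagram map is $T(P)_i=(p_ip_{i+2})\cap(p_{i+1}p_{i+3})$, defined when, for every $i$, these two lines are well defined and not parallel; $T^k$ is its $k$-th iterate. Put $C(P)=\frac1n\sum_i p_i$, $A^*(P)=\frac12\sum_i\det(p_i,p_{i+1})$ (oriented area), $\operatorname{Area}(P)=|A^*(P)|$. The area-normalized pentagram map is $$\widehat T(P)_i=C(P)+\sqrt{\tfrac{\operatorname{Area}(P)}{\operatorname{Area}(T(P))}}\,\bigl(T(P)_i-C(T(P))\bigr),$$ defined when $T(P)$ is defined and $\operatorname{Area}(P),\operatorname{Area}(T(P))>0$. Cyclic relabelling: $\Sigma_s(P)_i=p_{i+s}$. A projectivity is a projective transformation of $\mathbb{RP}^2$ given by a real invertible $3\times3$ matrix, acting on polygons vertexwise. Dominant real spectral line: a projective line $\ell_G=\mathbb{P}(E)$, where $E\subset\mathbb{R}^3$ is a real two-dimensional $G$-invariant subspace, in one of the following two cases. (1) $G$ has three real eigenvalues $|\mu_1|>|\mu_2|>|\mu_3|$ with eigenvectors $v_1,v_2,v_3$, and $E=\operatorname{span}\{v_1,v_2\}$. (2) $G$ has a non-real conjugate pair of eigenvalues $\mu,\overline\mu$ and a real eigenvalue $\nu$ with $|\mu|>|\nu|$, and $E=\operatorname{span}_{\mathbb{R}}\{\operatorname{Re}v,\operatorname{Im}v\}$ for an eigenvector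 $v\in\mathbb{C}^3$ of $\mu$. Centered two-scale asymptotic: a sequence $(Q_k)$ of labeled $n$-gons with nonzero area, $Q_k=(q_{k,1},\dots,q_{k,n})$, has a centered two-scale asymptotic in the direction $u$ if there exist a vector $v$ transverse to $u$, nonzero real sequences $\alpha_k,\beta_k$, and real numbers $a_i,b_i$ such that, writing $q_{k,i}-C(Q_k)=x_{k,i}u+y_{k,i}v$, one has $x_{k,i}/\alpha_k\to a_i$ and $y_{k,i}/\beta_k\to b_i$ for all $i$, and $|\beta_k|/|\alpha_k|\to0$. It is area-nondegenerate if $B=\frac12\sum_i\det(a_iu+b_iv,\;a_{i+1}u+b_{i+1}v)\ne0$. When $Q_k=G^k(Q)$, one says that $Q$ has the asymptotic under $G$. *)

theory Defs
  imports "HOL-Analysis.Analysis"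
begin

section \<open>Labeled polygons and the pentagram map\<close>

text \<open>A labeled \<open>n\<close>-gon is an \<open>n\<close>-periodic family of points of the plane; indices modulo \<open>n\<close>
  are thus ordinary integers.\<close>

type_synonym polygon = "int \<Rightarrow> real^2"

definition labeled_polygon :: "nat \<Rightarrow> polygon \<Rightarrow> bool" where
  "labeled_polygon n P \<longleftrightarrow> n \<ge> 1 \<and> (\<forall>i. P (i + int n) = P i)"

definition line_through :: "real^2 \<Rightarrow> real^2 \<Rightarrow> (real^2) set" where
  "line_through p q = affine hull {p, q}"

text \<open>\<open>affine_parallel\<close> is reflexive, so non-parallel lines are in particular distinct and meet in
  exactly one point.\<close>

definition pentagram_defined :: "polygon \<Rightarrow> bool" where
  "pentagram_defined P \<longleftrightarrow>
     (\<forall>i. P i \<noteq> P (i + 2) \<and> P (i + 1) \<noteq> P (i + 3) \<and>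
          \<not> affine_parallel (line_through (P i) (P (i + 2))) (line_through (P (i + 1)) (P (i + 3))))"

text \<open>The value is only meaningful when \<open>pentagram_defined\<close> holds.\<close>

definition pentagram :: "polygon \<Rightarrow> polygon" where
  "pentagram P i =
     (THE x. x \<in> line_through (P i) (P (i + 2)) \<inter> line_through (P (i + 1)) (P (i + 3)))"

definition centroid :: "nat \<Rightarrow> polygon \<Rightarrow> real^2" where
  "centroid n P = (1 / real n) *\<^sub>R (\<Sum>i\<in>{1..int n}. P i)"

definition oriented_area :: "nat \<Rightarrow> polygon \<Rightarrow> real" where
  "oriented_area n P = (1 / 2) * (\<Sum>i\<in>{1..int n}. det (vector [P i, P (i + 1)] :: real^2^2))"

definition area :: "nat \<Rightarrow> polygon \<Rightarrow> real" where
  "area n P = \<bar>oriented_area n P\<bar>"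

definition normalized_pentagram_defined :: "nat \<Rightarrow> polygon \<Rightarrow> bool" where
  "normalized_pentagram_defined n P \<longleftrightarrow>
     pentagram_defined P \<and> area n P > 0 \<and> area n (pentagram P) > 0"

definition normalized_pentagram :: "nat \<Rightarrow> polygon \<Rightarrow> polygon" where
  "normalized_pentagram n P i =
     centroid n P + sqrt (area n P / area n (pentagram P)) *\<^sub>R
       (pentagram P i - centroid n (pentagram P))"

definition relabel :: "int \<Rightarrow> (int \<Rightarrow> 'a) \<Rightarrow> (int \<Rightarrow> 'a)" where
  "relabel s P = (\<lambda>i. P (i + s))"


section \<open>The real projective plane\<close>

text \<open>Points of the real projective plane are the one-dimensional subspaces of \<open>real^3\<close>, and
  projective lines are sets of such points.\<close>

type_synonym proj_point = "(real^3) set"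

definition affine_point :: "real^2 \<Rightarrow> proj_point" where
  "affine_point x = span {vector [x $ 1, x $ 2, 1]}"

definition projectivization :: "(real^3) set \<Rightarrow> proj_point set" where
  "projectivization E = {span {h} | h. h \<in> E \<and> h \<noteq> 0}"

definition line_at_infinity :: "proj_point set" where
  "line_at_infinity = projectivization {h. h $ 3 = 0}"

text \<open>The action on points, for invertible \<open>G\<close>. Iterates of \<open>G\<close> are taken as iterates of this action,
  because \<open>G ^ k\<close> on the type \<open>real^3^3\<close> is the componentwise power.\<close>

definition proj_map :: "real^3^3 \<Rightarrow> proj_point \<Rightarrow> proj_point" where
  "proj_map G L = (\<lambda>h. G *v h) ` L"

definition proj_polygon :: "polygon \<Rightarrow> int \<Rightarrow> proj_point" where
  "proj_polygon P = (\<lambda>i. affine_point (P i))"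

definition proj_map_polygon :: "real^3^3 \<Rightarrow> (int \<Rightarrow> proj_point) \<Rightarrow> (int \<Rightarrow> proj_point)" where
  "proj_map_polygon G R = (\<lambda>i. proj_map G (R i))"


section \<open>Dominant real spectral lines\<close>

definition eigenpair :: "'a::field^'n^'n \<Rightarrow> 'a \<Rightarrow> 'a^'n \<Rightarrow> bool" where
  "eigenpair A \<mu> v \<longleftrightarrow> v \<noteq> 0 \<and> A *v v = \<mu> *s v"

definition dominant_real_plane :: "real^3^3 \<Rightarrow> (real^3) set \<Rightarrow> bool" where
  "dominant_real_plane G E \<longleftrightarrow>
     (\<exists>\<mu>1 \<mu>2 \<mu>3 v1 v2 v3.
        eigenpair G \<mu>1 v1 \<and> eigenpair G \<mu>2 v2 \<and> eigenpair G \<mu>3 v3 \<and>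
        \<bar>\<mu>1\<bar> > \<bar>\<mu>2\<bar> \<and> \<bar>\<mu>2\<bar> > \<bar>\<mu>3\<bar> \<and> E = span {v1, v2})"

text \<open>The conjugate of \<open>\<mu>\<close> is automatically an eigenvalue as well, \<open>G\<close> being real.\<close>

definition dominant_complex_plane :: "real^3^3 \<Rightarrow> (real^3) set \<Rightarrow> bool" where
  "dominant_complex_plane G E \<longleftrightarrow>
     (\<exists>\<mu> \<nu> v w.
        \<mu> \<notin> \<real> \<and> eigenpair (map_matrix complex_of_real G) \<mu> v \<and> eigenpair G \<nu> w \<and> cmod \<mu> > \<bar>\<nu>\<bar> \<and>
        E = span {\<chi> j. Re (v $ j), \<chi> j. Im (v $ j)})"

definition dominant_real_spectral_line :: "real^3^3 \<Rightarrow> proj_point set \<Rightarrow> bool" where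
  "dominant_real_spectral_line G l \<longleftrightarrow>
     (\<exists>E. subspace E \<and> dim E = 2 \<and> (\<forall>h\<in>E. G *v h \<in> E) \<and>
          (dominant_real_plane G E \<or> dominant_complex_plane G E) \<and>
          l = projectivization E)"

definition finite_affine_direction :: "proj_point set \<Rightarrow> real^2 \<Rightarrow> bool" where
  "finite_affine_direction l u \<longleftrightarrow>
     l \<noteq> line_at_infinity \<and> u \<noteq> 0 \<and>
     (\<exists>a. {x. affine_point x \<in> l} = range (\<lambda>t. a + t *\<^sub>R u))"


section \<open>Centered two-scale asymptotics\<close>

definition centered_two_scale_asymptotic_with ::
  "nat \<Rightarrow> (nat \<Rightarrow> polygon) \<Rightarrow> real^2 \<Rightarrow> real^2 \<Rightarrow> (nat \<Rightarrow> real) \<Rightarrow> (nat \<Rightarrow> real) \<Rightarrow>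
     (int \<Rightarrow> real) \<Rightarrow> (int \<Rightarrow> real) \<Rightarrow> bool" where
  "centered_two_scale_asymptotic_with n Q u v \<alpha> \<beta> a b \<longleftrightarrow>
     (\<forall>k. labeled_polygon n (Q k) \<and> area n (Q k) \<noteq> 0) \<and>
     u \<noteq> v \<and> independent {u, v} \<and>
     (\<forall>k. \<alpha> k \<noteq> 0 \<and> \<beta> k \<noteq> 0) \<and>
     (\<exists>x y. (\<forall>k i. Q k i - centroid n (Q k) = x k i *\<^sub>R u + y k i *\<^sub>R v) \<and>
            (\<forall>i. (\<lambda>k. x k i / \<alpha> k) \<longlonglongrightarrow> a i) \<and>
            (\<forall>i. (\<lambda>k. y k i / \<beta> k) \<longlonglongrightarrow> b i)) \<and>
     (\<lambda>k. \<bar>\<beta> k\<bar> / \<bar>\<alpha> k\<bar>) \<longlonglongrightarrow> 0"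

definition area_nondegenerate_asymptotic :: "nat \<Rightarrow> (nat \<Rightarrow> polygon) \<Rightarrow> real^2 \<Rightarrow> bool" where
  "area_nondegenerate_asymptotic n Q u \<longleftrightarrow>
     (\<exists>v \<alpha> \<beta> a b. centered_two_scale_asymptotic_with n Q u v \<alpha> \<beta> a b \<and>
        oriented_area n (\<lambda>i. a i *\<^sub>R u + b i *\<^sub>R v) \<noteq> 0)"

text \<open>The iterates \<open>G\<^sup>k(Q)\<close> are polygons in the projective plane; the asymptotic requires all of them
  to lie in the affine plane.\<close>

definition area_nondegenerate_asymptotic_under ::
  "nat \<Rightarrow> real^3^3 \<Rightarrow> polygon \<Rightarrow> real^2 \<Rightarrow> bool" where
  "area_nondegenerate_asymptotic_under n G Q u \<longleftrightarrow>
     (\<exists>Qs. (\<forall>k. proj_polygon (Qs k) = (proj_map_polygon G ^^ k) (proj_polygon Q)) \<and>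
           area_nondegenerate_asymptotic n Qs u)"

end

theory Submission
  imports Defs
begin

text \<open>The pentagram map commutes with similarities and with projectivities. The first fact shows that
  the normalized iterate is \<open>C(P) + t\<^sub>k (T\<^sup>k(P) - C(T\<^sup>k(P)))\<close> with \<open>t\<^sub>k = sqrt (Area(P) / Area(T\<^sup>k(P)))\<close>;
  the second one shows that \<open>T\<^bsup>mq+r\<^esup>(P)\<close> is a relabelling of \<open>G\<^sup>q(T\<^sup>r(P))\<close>. Along each residue class
  the area is \<open>\<alpha>\<^sub>q \<beta>\<^sub>q (B + o(1))\<close> up to sign, so after normalization the transverse coordinates are of order
  \<open>sqrt |\<beta>\<^sub>q / \<alpha>\<^sub>q|\<close>, which tends to zero, and those along \<open>u\<close> are of the reciprocal order. As \<open>B \<noteq> 0\<close>, the limits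
  \<open>a\<^sub>i\<close> are not all equal, and the diameter diverges.\<close>

section \<open>Periodic families indexed by the integers\<close>

lemma periodic_add_mult:
  fixes f :: "int \<Rightarrow> 'a"
  assumes "\<And>i. f (i + int n) = f i"
  shows "f (i + k * int n) = f i"
proof (induction k rule: int_induct[where k = 0])
  case base
  then show ?case by simp
next
  case (step1 k)
  then show ?case using assms[of "i + k * int n"] by (simp add: algebra_simps)
next
  case (step2 k)
  then show ?case using assms[of "i + (k - 1) * int n"] by (simp add: algebra_simps)
qed

lemma periodic_image:
  fixes f :: "int \<Rightarrow> 'a"
  assumes "\<And>i. f (i + int n) = f i" "n \<ge> 1"
  shows "f ` {1..int n} = range f"
proof -
  have "f i \<in> f ` {1..int n}" for i
  proof (rule image_eqI)
    \<comment> \<open>The window starts at 1 instead of 0, so the representative of \<open>i\<close>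
      is found by reducing \<open>i - 1\<close> and adding 1 back.\<close>
    have "i = ((i - 1) mod int n + 1) + ((i - 1) div int n) * int n"
      using mult_div_mod_eq[of "int n" "i - 1"] by (simp add: algebra_simps)
    then show "f i = f ((i - 1) mod int n + 1)"
      using periodic_add_mult[where f = f and n = n] assms(1) by metis
    show "(i - 1) mod int n + 1 \<in> {1..int n}"
    proof -
      have "(i - 1) mod int n < int n" using assms(2) by (intro pos_mod_bound) auto
      moreover have "0 \<le> (i - 1) mod int n" using assms(2) by (intro pos_mod_sign) auto
      ultimately show ?thesis unfolding atLeastAtMost_iff by linarith
    qed
  qed
  then show ?thesis by auto
qed

text \<open>Moving the window by one exchanges \<open>f 1\<close> for \<open>f (1 + int n)\<close>.
  As only this pair of values is compared, the lemma also applies to the limits \<open>b i\<close>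
  below, whose periodicity is established at one index.\<close>

lemma periodic_sum_Suc:
  fixes f :: "int \<Rightarrow> 'a::ab_group_add"
  assumes "f (1 + int n) = f 1"
  shows "(\<Sum>i\<in>{1..int n}. f (i + 1)) = (\<Sum>i\<in>{1..int n}. f i)"
proof (cases "n = 0")
  case False
  have "(\<Sum>i\<in>{1..int n}. f (i + 1)) = (\<Sum>i\<in>{2..int n + 1}. f i)"
    by (rule sum.reindex_bij_witness[where i = "\<lambda>i. i - 1" and j = "\<lambda>i. i + 1"]) auto
  moreover have "{1..int n + 1} = insert 1 {2..int n + 1}" "{1..int n + 1} = insert (int n + 1) {1..int n}"
    using False by auto
  then have "f 1 + (\<Sum>i\<in>{2..int n + 1}. f i) = f (int n + 1) + (\<Sum>i\<in>{1..int n}. f i)"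
    by (metis (no_types, lifting) finite_atLeastAtMost_int sum.insert atLeastAtMost_iff
        one_le_numeral not_less numeral_One semiring_norm(69) numeral_le_iff less_add_one)
  ultimately show ?thesis using assms by (simp add: add.commute)
qed simp

lemma periodic_sum_shift:
  fixes f :: "int \<Rightarrow> 'a::ab_group_add"
  assumes "\<And>i. f (i + int n) = f i"
  shows "(\<Sum>i\<in>{1..int n}. f (i + s)) = (\<Sum>i\<in>{1..int n}. f i)"
proof -
  have shift: "(\<Sum>i\<in>{1..int n}. f (i + (k + 1))) = (\<Sum>i\<in>{1..int n}. f (i + k))" for k
    using periodic_sum_Suc[of "\<lambda>i. f (i + k)" n] assms[of "1 + k"]
    by (simp add: algebra_simps)
  show ?thesis
  proof (induction s rule: int_induct[where k = 0])
    case (step1 k)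
    then show ?case using shift[of k] by simp
  next
    case (step2 k)
    then show ?case using shift[of "k - 1"] by simp
  qed simp
qed


section \<open>Lines in the plane\<close>

text \<open>The determinant of two vectors, that is, the standard area form. Being bilinear, it
  turns incidence and parallelism of lines into polynomial equations.\<close>

definition cross :: "real^2 \<Rightarrow> real^2 \<Rightarrow> real" where
  "cross p q = p $ 1 * q $ 2 - p $ 2 * q $ 1"

lemma vec2_eq_iff: "(x :: real^2) = y \<longleftrightarrow> x $ 1 = y $ 1 \<and> x $ 2 = y $ 2"
  by (simp add: vec_eq_iff forall_2)

lemma oriented_area_cross:
  "oriented_area n P = (1/2) * (\<Sum>i\<in>{1..int n}. cross (P i) (P (i + 1)))"
  by (simp add: oriented_area_def det_2 cross_def)

lemma cross_eq_0_iff: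
  assumes "d \<noteq> 0"
  shows "cross d x = 0 \<longleftrightarrow> (\<exists>t. x = t *\<^sub>R d)"
proof
  assume *: "cross d x = 0"
  show "\<exists>t. x = t *\<^sub>R d"
  proof (cases "d $ 1 = 0")
    case True
    then have "d $ 2 \<noteq> 0" using assms by (simp add: vec2_eq_iff)
    then have "x = (x $ 2 / d $ 2) *\<^sub>R d" using * True by (simp add: vec2_eq_iff cross_def)
    then show ?thesis ..
  next
    case False
    then have "x = (x $ 1 / d $ 1) *\<^sub>R d"
      using * by (simp add: vec2_eq_iff cross_def field_simps)
    then show ?thesis ..
  qed
qed (auto simp: cross_def)

lemma cross_independent:
  assumes "independent {u, v}" "u \<noteq> v"
  shows "cross u v \<noteq> 0"
proof
  assume *: "cross u v = 0"
  have "u \<noteq> 0" using assms dependent_zero by blast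
  with * obtain t where "v = t *\<^sub>R u" using cross_eq_0_iff by blast
  then have "v \<in> span {u}" by (simp add: span_base span_scale)
  moreover have "v \<notin> span ({u, v} - {v})" using assms(1) by (auto simp: dependent_def)
  ultimately show False using assms(2) by (simp add: insert_Diff_if)
qed

lemma line_through_iff: "x \<in> line_through p q \<longleftrightarrow> (\<exists>t. x = p + t *\<^sub>R (q - p))"
  by (auto simp: line_through_def affine_hull_2_alt)

lemma line_through_cross:
  assumes "p \<noteq> q"
  shows "x \<in> line_through p q \<longleftrightarrow> cross (q - p) (x - p) = 0"
proof -
  have "x \<in> line_through p q \<longleftrightarrow> (\<exists>t. x - p = t *\<^sub>R (q - p))"
    unfolding line_through_iff by (metis add_diff_cancel_left' add.commute diff_add_cancel)
  then show ?thesis using assms by (subst cross_eq_0_iff) auto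
qed

text \<open>Both sides say that the directions are proportional. Conversely the translation takes
  \<open>p\<close> to \<open>r\<close>, and the factor between the directions only reparametrizes
  the line.\<close>

lemma affine_parallel_cross:
  assumes "p \<noteq> q" "r \<noteq> s"
  shows "affine_parallel (line_through p q) (line_through r s) \<longleftrightarrow> cross (q - p) (s - r) = 0"
proof
  assume "affine_parallel (line_through p q) (line_through r s)"
  then obtain a where a: "line_through r s = (\<lambda>x. a + x) ` line_through p q"
    by (auto simp: affine_parallel_def)
  have "r \<in> line_through r s" "s \<in> line_through r s"
    by (auto simp: line_through_def hull_inc)
  then have "r \<in> (\<lambda>x. a + x) ` line_through p q" "s \<in> (\<lambda>x. a + x) ` line_through p q"
    unfolding a by auto
  then obtain t t' where rs: "r = a + (p + t *\<^sub>R (q - p))" "s = a + (p + t' *\<^sub>R (q - p))"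
    by (auto simp: image_iff Bex_def line_through_iff)
  have "s - r = (t' - t) *\<^sub>R (q - p)" unfolding rs by (simp add: algebra_simps)
  then show "cross (q - p) (s - r) = 0" using assms by (subst cross_eq_0_iff) auto
next
  assume "cross (q - p) (s - r) = 0"
  then obtain c where c: "s - r = c *\<^sub>R (q - p)" using assms cross_eq_0_iff[of "q - p"] by auto
  then have "c \<noteq> 0" using assms by auto
  have "line_through r s = (\<lambda>x. (r - p) + x) ` line_through p q"
  proof (intro set_eqI iffI)
    fix x assume "x \<in> line_through r s"
    then obtain t where "x = r + t *\<^sub>R (s - r)" using line_through_iff by auto
    then have "x = (r - p) + (p + (t * c) *\<^sub>R (q - p))" using c by simp
    then show "x \<in> (\<lambda>x. (r - p) + x) ` line_through p q" using line_through_iff by blast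
  next
    fix x assume "x \<in> (\<lambda>x. (r - p) + x) ` line_through p q"
    then obtain z where "x = (r - p) + z" "z \<in> line_through p q" by blast
    moreover from this obtain t where "z = p + t *\<^sub>R (q - p)" using line_through_iff by blast
    ultimately have "x = r + (t / c) *\<^sub>R (s - r)" using c \<open>c \<noteq> 0\<close> by simp
    then show "x \<in> line_through r s" using line_through_iff by blast
  qed
  then show "affine_parallel (line_through p q) (line_through r s)"
    unfolding affine_parallel_def by blast
qed

text \<open>Cramer's rule for the linear system \<open>cross d x = 0\<close>,
  \<open>cross e x = 0\<close>, whose determinant is \<open>cross d e\<close>.\<close>

lemma cross_eq_0_unique:
  assumes "cross d e \<noteq> 0" "cross d x = 0" "cross e x = 0"
  shows "x = 0"
proof -
  have "cross d e * x $ 1 = e $ 1 * cross d x - d $ 1 * cross e x"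
    "cross d e * x $ 2 = e $ 2 * cross d x - d $ 2 * cross e x"
    by (simp_all add: cross_def algebra_simps)
  then show ?thesis using assms by (simp add: vec2_eq_iff)
qed


section \<open>Equivariance of the pentagram map\<close>

text \<open>If two endpoints coincide, a difference vector vanishes; so one inequality covers the
  nondegeneracy of both lines as well as their non-parallelism.\<close>

lemma pentagram_defined_cross:
  "pentagram_defined P \<longleftrightarrow> (\<forall>i. cross (P (i + 2) - P i) (P (i + 3) - P (i + 1)) \<noteq> 0)"
proof -
  have "cross (P (i + 2) - P i) (P (i + 3) - P (i + 1)) \<noteq> 0 \<longleftrightarrow>
      P i \<noteq> P (i + 2) \<and> P (i + 1) \<noteq> P (i + 3) \<and>
      \<not> affine_parallel (line_through (P i) (P (i + 2))) (line_through (P (i + 1)) (P (i + 3)))" for i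
  proof (cases "P i \<noteq> P (i + 2) \<and> P (i + 1) \<noteq> P (i + 3)")
    case True
    then show ?thesis using affine_parallel_cross by auto
  qed (auto simp: cross_def)
  then show ?thesis by (simp add: pentagram_defined_def)
qed

text \<open>Directions with nonzero determinant give existence and uniqueness of the intersection,
  which eliminates the definite description. Equivariance then reduces to exhibiting a point on both
  image lines.\<close>

lemma pentagram_eq_iff:
  assumes "pentagram_defined P"
  shows "pentagram P i = x \<longleftrightarrow>
    x \<in> line_through (P i) (P (i + 2)) \<and> x \<in> line_through (P (i + 1)) (P (i + 3))"
proof -
  define p q r s where pq: "p = P i" "q = P (i + 2)" "r = P (i + 1)" "s = P (i + 3)"
  have ne: "p \<noteq> q" "r \<noteq> s" using assms by (auto simp: pentagram_defined_def pq)
  have c: "cross (q - p) (s - r) \<noteq> 0" using assms by (simp add: pentagram_defined_cross pq)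
  define S where "S = line_through p q \<inter> line_through r s"
  have uniq: "x = y" if "x \<in> S" "y \<in> S" for x y
  proof -
    have "cross (q - p) (x - p) = 0" "cross (q - p) (y - p) = 0"
      "cross (s - r) (x - r) = 0" "cross (s - r) (y - r) = 0"
      using that ne by (auto simp: S_def line_through_cross)
    then have "cross (q - p) (x - y) = 0" "cross (s - r) (x - y) = 0"
      by (auto simp: cross_def algebra_simps)
    then show ?thesis using cross_eq_0_unique[OF c, of "x - y"] by simp
  qed
  \<comment> \<open>The coefficient is the root \<open>k\<close> of
    \<open>cross (s - r) (p + k *\<^sub>R (q - p) - r) = 0\<close>, an equation linear in
    \<open>k\<close>.\<close>
  have ex: "p + (cross (r - p) (s - r) / cross (q - p) (s - r)) *\<^sub>R (q - p) \<in> S" (is "?x \<in> S")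
  proof -
    let ?t = "cross (r - p) (s - r) / cross (q - p) (s - r)"
    have "cross (s - r) (p + k *\<^sub>R (q - p) - r) = cross (r - p) (s - r) - k * cross (q - p) (s - r)" for k
      by (simp add: cross_def algebra_simps)
    then have "cross (s - r) (?x - r) = cross (r - p) (s - r) - ?t * cross (q - p) (s - r)" .
    also have "\<dots> = 0" using c by simp
    finally show ?thesis using ne by (auto simp: S_def line_through_cross[of r] line_through_iff[of _ p])
  qed
  have "(THE x. x \<in> S) = x \<longleftrightarrow> x \<in> S" for x
    using ex uniq by (metis the_equality)
  then show ?thesis by (simp add: pentagram_def pq S_def)
qed

lemma pentagram_in_lines:
  assumes "pentagram_defined P"
  shows "pentagram P i \<in> line_through (P i) (P (i + 2))"
    and "pentagram P i \<in> line_through (P (i + 1)) (P (i + 3))"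
  using pentagram_eq_iff[OF assms] by auto

lemma labeled_polygon_pentagram:
  "labeled_polygon n P \<Longrightarrow> labeled_polygon n (pentagram P)"
proof -
  assume P: "labeled_polygon n P"
  then have "P (i + int n + j) = P (i + j)" for i j
    by (metis labeled_polygon_def add.assoc add.commute)
  moreover have "P (i + int n) = P i" for i
    using P by (simp add: labeled_polygon_def)
  ultimately show ?thesis using P by (simp add: labeled_polygon_def pentagram_def)
qed

lemma labeled_polygon_funpow:
  "labeled_polygon n P \<Longrightarrow> labeled_polygon n ((pentagram ^^ k) P)"
  by (induction k) (auto simp: labeled_polygon_pentagram)

section \<open>Similarities and the closed form of the normalized iterates\<close>

text \<open>Two base points are kept because normalization moves one centroid to another: if
  \<open>d\<close> is the centroid of \<open>P\<close>, the image has centroid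
  \<open>c\<close>.\<close>

definition dilate :: "real^2 \<Rightarrow> real \<Rightarrow> real^2 \<Rightarrow> polygon \<Rightarrow> polygon" where
  "dilate c t d P = (\<lambda>i. c + t *\<^sub>R (P i - d))"

lemma pentagram_defined_dilate:
  assumes "t \<noteq> 0" "pentagram_defined P"
  shows "pentagram_defined (dilate c t d P)"
proof -
  have "cross (dilate c t d P i - dilate c t d P j) (dilate c t d P k - dilate c t d P l) =
      t\<^sup>2 * cross (P i - P j) (P k - P l)" for i j k l
    by (simp add: dilate_def cross_def algebra_simps power2_eq_square)
  then show ?thesis using assms by (simp add: pentagram_defined_cross)
qed

text \<open>An affine map keeps the parameter of a point on a line, so the image of the old
  intersection lies on both new lines.\<close>

lemma pentagram_dilate:
  assumes "t \<noteq> 0" "pentagram_defined P"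
  shows "pentagram (dilate c t d P) = dilate c t d (pentagram P)"
proof
  fix i
  have line: "dilate c t d (pentagram P) i \<in> line_through (dilate c t d P j) (dilate c t d P k)"
    if on_line: "pentagram P i \<in> line_through (P j) (P k)" for j k
  proof -
    obtain a where a: "pentagram P i = P j + a *\<^sub>R (P k - P j)"
      using on_line line_through_iff by auto
    have "dilate c t d (pentagram P) i =
        dilate c t d P j + a *\<^sub>R (dilate c t d P k - dilate c t d P j)"
      unfolding dilate_def a by (simp add: algebra_simps)
    then show ?thesis using line_through_iff by blast
  qed
  show "pentagram (dilate c t d P) i = dilate c t d (pentagram P) i"
    using pentagram_eq_iff[OF pentagram_defined_dilate[OF assms]] line pentagram_in_lines[OF assms(2)]
    by blast
qed

lemma centroid_dilate:
  "n \<ge> 1 \<Longrightarrow> centroid n (dilate c t d P) = c + t *\<^sub>R (centroid n P - d)"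
  by (simp add: centroid_def dilate_def sum.distrib sum_subtractf scaleR_sum_right[symmetric]
      scaleR_right_diff_distrib scaleR_right_distrib sum_constant_scaleR
      del: sum_constant)

lemma oriented_area_dilate:
  assumes "labeled_polygon n P"
  shows "oriented_area n (dilate c t d P) = t\<^sup>2 * oriented_area n P"
proof -
  have per: "P (1 + int n) = P 1" using assms by (simp add: labeled_polygon_def)
  \<comment> \<open>The vertices of the image are \<open>e + t *\<^sub>R P i\<close>. The constant
    \<open>e\<close> contributes only a telescoping sum to the area, which vanishes around a closed
    polygon.\<close>
  define e where "e = c - t *\<^sub>R d"
  have "cross (dilate c t d P i) (dilate c t d P (i + 1)) =
      t\<^sup>2 * cross (P i) (P (i + 1)) + t * (cross e (P (i + 1)) - cross e (P i))" for i
    by (simp add: e_def cross_def dilate_def algebra_simps power2_eq_square)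
  then show ?thesis
    using periodic_sum_Suc[of "\<lambda>i. cross e (P i)" n] per
    by (simp add: oriented_area_cross sum.distrib sum_subtractf sum_distrib_left[symmetric])
qed

lemma area_dilate:
  "labeled_polygon n P \<Longrightarrow> area n (dilate c t d P) = t\<^sup>2 * area n P"
  by (simp add: area_def oriented_area_dilate abs_mult)

lemma normalized_pentagram_dilate:
  "normalized_pentagram n P = dilate (centroid n P) (sqrt (area n P / area n (pentagram P)))
    (centroid n (pentagram P)) (pentagram P)"
  by (simp add: fun_eq_iff normalized_pentagram_def dilate_def)

text \<open>A normalized step keeps both the centroid and the area, so every step is measured
  against the fixed \<open>area n P\<close> and the successive factors telescope to
  \<open>t k\<close>.\<close>

lemma normalized_pentagram_funpow:
  assumes P: "labeled_polygon n P" "area n P > 0"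
    and iter: "\<forall>k. pentagram_defined ((pentagram ^^ k) P) \<and> area n ((pentagram ^^ k) P) \<noteq> 0"
  shows "(normalized_pentagram n ^^ k) P =
      dilate (centroid n P) (sqrt (area n P / area n ((pentagram ^^ k) P)))
        (centroid n ((pentagram ^^ k) P)) ((pentagram ^^ k) P)"
    and "normalized_pentagram_defined n ((normalized_pentagram n ^^ k) P)"
proof -
  define Q where "Q k = (pentagram ^^ k) P" for k
  define t where "t k = sqrt (area n P / area n (Q k))" for k
  define R where "R k = dilate (centroid n P) (t k) (centroid n (Q k)) (Q k)" for k
  have Q_Suc: "Q (Suc k) = pentagram (Q k)" for k by (simp add: Q_def)
  have Q: "pentagram_defined (Q k)" "area n (Q k) > 0" "labeled_polygon n (Q k)" for k
  proof -
    show "area n (Q k) > 0" using iter by (simp add: Q_def area_def)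
  qed (use iter P labeled_polygon_funpow in \<open>auto simp: Q_def\<close>)
  have n: "n \<ge> 1" using P by (simp add: labeled_polygon_def)
  have t: "t k > 0" for k using Q(2)[of k] P by (simp add: t_def)
  have tt: "(t k)\<^sup>2 = area n P / area n (Q k)" for k
    using Q(2)[of k] P by (simp add: t_def)
  have area_R: "area n (R k) = area n P" for k
    using Q[of k] by (simp add: R_def area_dilate tt)
  have TR: "pentagram (R k) = dilate (centroid n P) (t k) (centroid n (Q k)) (Q (Suc k))" for k
    using t[of k] Q by (simp add: R_def pentagram_dilate Q_Suc)
  have area_TR: "area n (pentagram (R k)) = (t k)\<^sup>2 * area n (Q (Suc k))" for k
    by (simp add: TR area_dilate Q)
  have cR: "centroid n (R k) = centroid n P" for k
    using n by (simp add: R_def centroid_dilate)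
  have defd: "normalized_pentagram_defined n (R k)" for k
    unfolding normalized_pentagram_defined_def area_R area_TR
    using t[of k] Q[of k] Q(2)[of "Suc k"] P pentagram_defined_dilate by (simp add: R_def)
  have step: "normalized_pentagram n (R k) = R (Suc k)" for k
  proof -
    have "sqrt (area n P / ((t k)\<^sup>2 * area n (Q (Suc k)))) * t k = t (Suc k)"
      using t[of k] by (simp add: t_def[of "Suc k"] real_sqrt_mult real_sqrt_divide)
    then have *: "sqrt (area n P / ((t k)\<^sup>2 * area n (Q (Suc k)))) *\<^sub>R t k *\<^sub>R x = t (Suc k) *\<^sub>R x" for x :: "real^2"
      by simp
    \<comment> \<open>The inner scaling takes \<open>h\<close> to the base point of the outer one,
      so \<open>f\<close> and \<open>d\<close> cancel from the composite.\<close>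
    have "dilate e r (f + t k *\<^sub>R (h - d)) (dilate f (t k) d X) = (\<lambda>i. e + r *\<^sub>R t k *\<^sub>R (X i - h))" for e r f h d X
      by (simp add: dilate_def fun_eq_iff flip: scaleR_diff_right)
    then show ?thesis
      unfolding normalized_pentagram_dilate area_R area_TR cR
      unfolding TR centroid_dilate[OF n] by (simp only: * R_def dilate_def)
  qed
  have R: "(normalized_pentagram n ^^ k) P = R k" for k
  proof (induction k)
    case 0
    \<comment> \<open>At \<open>k = 0\<close> the ratio is \<open>sqrt 1\<close>, the area being
      positive, and the base points agree: the dilation is the identity.\<close>
    then show ?case using P by (simp add: R_def Q_def t_def dilate_def)
  next
    case (Suc k)
    then show ?case using step by simp
  qed
  show "normalized_pentagram_defined n ((normalized_pentagram n ^^ k) P)"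
    using defd R by simp
  show "(normalized_pentagram n ^^ k) P =
      dilate (centroid n P) (sqrt (area n P / area n ((pentagram ^^ k) P)))
        (centroid n ((pentagram ^^ k) P)) ((pentagram ^^ k) P)"
    by (simp add: R R_def t_def Q_def)
qed

section \<open>Homogeneous coordinates and projective equivariance\<close>

definition lift :: "real^2 \<Rightarrow> real^3" where
  "lift x = vector [x $ 1, x $ 2, 1]"

lemma lift_nth [simp]: "lift x $ 1 = x $ 1" "lift x $ 2 = x $ 2" "lift x $ 3 = 1"
  by (simp_all add: lift_def)

lemma vec3_eq_iff: "(x :: real^3) = y \<longleftrightarrow> x $ 1 = y $ 1 \<and> x $ 2 = y $ 2 \<and> x $ 3 = y $ 3"
  by (simp add: vec_eq_iff forall_3)

lemma affine_point_lift: "affine_point x = span {lift x}"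
  by (simp add: affine_point_def lift_def)

lemma affine_point_inj: "affine_point x = affine_point y \<Longrightarrow> x = y"
proof -
  assume "affine_point x = affine_point y"
  then have "lift x \<in> span {lift y}" using span_base affine_point_lift by blast
  then obtain c where "lift x = c *\<^sub>R lift y" by (auto simp: span_singleton)
  then show ?thesis by (simp add: vec3_eq_iff vec2_eq_iff)
qed

lemma proj_map_span: "proj_map G (span {h}) = span {G *v h}"
  unfolding proj_map_def using linear_span_image[of "(*v) G" "{h}"] by simp

text \<open>A line becomes a two-dimensional linear span, on which \<open>G\<close> acts linearly.
  The coefficients are not normalized: their sum is the third coordinate of the image, which
  vanishes if the image point is at infinity.\<close>

lemma line_through_lift:
  assumes "X \<in> line_through p q" "affine_point p' = proj_map G (affine_point p)"
    "affine_point q' = proj_map G (affine_point q)"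
  obtains a b where "G *v lift X = a *\<^sub>R lift p' + b *\<^sub>R lift q'"
proof -
  obtain t where t: "X = p + t *\<^sub>R (q - p)" using assms line_through_iff by auto
  have "lift X = (1 - t) *\<^sub>R lift p + t *\<^sub>R lift q"
    unfolding t by (simp add: vec3_eq_iff algebra_simps)
  then have X: "G *v lift X = (1 - t) *\<^sub>R (G *v lift p) + t *\<^sub>R (G *v lift q)"
    by (simp add: matrix_vector_right_distrib matrix_vector_mult_scaleR)
  have "G *v lift p \<in> span {lift p'}" "G *v lift q \<in> span {lift q'}"
    using assms by (simp_all add: affine_point_lift proj_map_span span_base)
  then obtain a b where "G *v lift p = a *\<^sub>R lift p'" "G *v lift q = b *\<^sub>R lift q'"
    by (auto simp: span_singleton)
  then have "G *v lift X = ((1 - t) * a) *\<^sub>R lift p' + (t * b) *\<^sub>R lift q'" using X by simp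
  then show thesis using that by blast
qed

text \<open>\<open>G\<close> carries lines to lines, so the image of the intersection lies on both
  image lines. A projectivity can send that point to infinity, and
  \<open>pentagram_defined P'\<close> excludes this.\<close>

lemma pentagram_projective:
  assumes G: "invertible G" and P: "pentagram_defined P" "pentagram_defined P'"
    and rel: "\<And>i. affine_point (P' i) = proj_map G (affine_point (P (i + s)))"
  shows "affine_point (pentagram P' i) = proj_map G (affine_point (pentagram P (i + s)))"
proof -
  define p q r t where pq: "p = P' i" "q = P' (i + 2)" "r = P' (i + 1)" "t = P' (i + 3)"
  define z where "z = G *v lift (pentagram P (i + s))"
  have idx: "i + 2 + s = i + s + 2" "i + 1 + s = i + s + 1" "i + 3 + s = i + s + 3" by auto
  obtain a b where ab: "z = a *\<^sub>R lift p + b *\<^sub>R lift q"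
    using line_through_lift[OF pentagram_in_lines(1)[OF P(1)] rel[of i] rel[of "i + 2", unfolded idx]]
    unfolding z_def pq by blast
  obtain c d where cd: "z = c *\<^sub>R lift r + d *\<^sub>R lift t"
    using line_through_lift[OF pentagram_in_lines(2)[OF P(1)]
        rel[of "i + 1", unfolded idx] rel[of "i + 3", unfolded idx]]
    unfolding z_def pq by blast
  have "inj ((*v) G)" using G by (rule inj_matrix_vector_mult)
  moreover have "lift (pentagram P (i + s)) \<noteq> 0" by (simp add: vec3_eq_iff)
  ultimately have z0: "z \<noteq> 0"
    unfolding z_def by (metis injD matrix_vector_mult_0_right)
  have z3: "z $ 3 = a + b" "z $ 3 = c + d"
    using ab by simp (use cd in simp)
  define y :: "real^2" where "y = vector [z $ 1, z $ 2]"
  have y: "y = a *\<^sub>R p + b *\<^sub>R q" "y = c *\<^sub>R r + d *\<^sub>R t"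
    using ab by (simp add: y_def vec2_eq_iff) (use cd in \<open>simp add: y_def vec2_eq_iff\<close>)
  have cr: "cross (q - p) (t - r) \<noteq> 0" using P(2) by (simp add: pentagram_defined_cross pq)
  \<comment> \<open>A point \<open>z\<close> at infinity would be a common direction of the two lines.\<close>
  have z3_nz: "z $ 3 \<noteq> 0"
  proof
    assume 0: "z $ 3 = 0"
    then have neg: "a = - b" "c = - d" using z3 by auto
    have "y = b *\<^sub>R (q - p)" unfolding y(1) neg by (simp add: algebra_simps)
    moreover have "y = d *\<^sub>R (t - r)" unfolding y(2) neg by (simp add: algebra_simps)
    moreover have "cross e (k *\<^sub>R e) = 0" for k e by (simp add: cross_def)
    ultimately have "cross (q - p) y = 0" "cross (t - r) y = 0" by metis+
    then have "y = 0" using cross_eq_0_unique[OF cr] by auto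
    then have "z $ 1 = 0 \<and> z $ 2 = 0" by (simp add: y_def vec2_eq_iff)
    then show False using 0 z0 by (simp add: vec3_eq_iff)
  qed
  define x where "x = (1 / z $ 3) *\<^sub>R y"
  \<comment> \<open>Dividing by \<open>z $ 3\<close> makes the two weights sum to one, so the
    homogeneous combination becomes an affine one.\<close>
  have on_line: "x = p' + (b' / z $ 3) *\<^sub>R (q' - p')"
    if "y = a' *\<^sub>R p' + b' *\<^sub>R q'" "z $ 3 = a' + b'" for a' b' p' q'
  proof -
    have "z $ 3 *\<^sub>R (p' + (b' / z $ 3) *\<^sub>R (q' - p')) = y"
      using z3_nz that(1) by (simp add: scaleR_add_right) (simp add: that(2) algebra_simps)
    then show ?thesis using z3_nz by (auto simp: x_def)
  qed
  have "x \<in> line_through p q" "x \<in> line_through r t"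
    using on_line y z3 line_through_iff by blast+
  then have x: "pentagram P' i = x" using pentagram_eq_iff[OF P(2)] by (simp add: pq)
  define k where "k = z $ 3"
  have k: "k \<noteq> 0" using z3_nz by (simp add: k_def)
  have zk: "z = k *\<^sub>R lift x"
    using z3_nz by (simp add: k_def vec3_eq_iff x_def y_def)
  have "(1 / k) *\<^sub>R z \<in> span {z}" by (intro span_scale span_base) simp
  then have "lift x \<in> span {z}" using k by (simp add: zk)
  moreover have "z \<in> span {lift x}" unfolding zk by (intro span_scale span_base) simp
  ultimately have "span {lift x} = span {z}" unfolding span_eq by blast
  then show ?thesis unfolding x affine_point_lift proj_map_span z_def .
qed

lemma funpow_pentagram_projective:
  assumes G: "invertible G" and P: "\<And>k. pentagram_defined ((pentagram ^^ k) P)"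
    and rel: "proj_polygon ((pentagram ^^ m) P) = relabel s (proj_map_polygon G (proj_polygon P))"
  shows "proj_polygon ((pentagram ^^ (m * q + r)) P) =
    relabel (s * int q) ((proj_map_polygon G ^^ q) (proj_polygon ((pentagram ^^ r) P)))"
proof -
  \<comment> \<open>The relation between \<open>(pentagram ^^ m) P\<close> and \<open>P\<close> is
    first carried to later iterates with the same \<open>G\<close> and \<open>s\<close>. Each
    further block of \<open>m\<close> iterations then contributes one \<open>G\<close> and one shift
    by \<open>s\<close>.\<close>
  have step: "affine_point ((pentagram ^^ (m + r)) P i) =
      proj_map G (affine_point ((pentagram ^^ r) P (i + s)))" for r i
  proof (induction r arbitrary: i)
    case 0
    then show ?case
      using fun_cong[OF rel, of i] by (simp add: proj_polygon_def relabel_def proj_map_polygon_def)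
  next
    case (Suc r)
    then show ?case using pentagram_projective[OF G P[of r] P[of "m + r"]] by simp
  qed
  show ?thesis
  proof (induction q)
    case 0
    then show ?case by (simp add: relabel_def)
  next
    case (Suc q)
    define X where "X = (proj_map_polygon G ^^ q) (proj_polygon ((pentagram ^^ r) P))"
    have "proj_polygon ((pentagram ^^ (m * Suc q + r)) P) i =
        proj_map G (proj_polygon ((pentagram ^^ (m * q + r)) P) (i + s))" for i
      using step[of "m * q + r" i] by (simp add: proj_polygon_def add.assoc)
    moreover have "proj_map G (proj_polygon ((pentagram ^^ (m * q + r)) P) (i + s)) =
        relabel (s * int (Suc q)) (proj_map_polygon G X) i" for i
      unfolding Suc.IH by (simp add: X_def[symmetric] relabel_def proj_map_polygon_def algebra_simps)
    ultimately show ?case by (simp add: fun_eq_iff X_def)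
  qed
qed


section \<open>Two-scale asymptotics of normalized polygons\<close>

lemma cross_coords:
  "cross (x *\<^sub>R u + y *\<^sub>R v) (x' *\<^sub>R u + y' *\<^sub>R v) = (x * y' - y * x') * cross u v"
  by (simp add: cross_def algebra_simps)

lemma oriented_area_coords:
  "oriented_area n (\<lambda>i. x i *\<^sub>R u + y i *\<^sub>R v) =
    (1/2) * (\<Sum>i\<in>{1..int n}. (x i * y (i + 1) - y i * x (i + 1)) * cross u v)"
  by (simp add: oriented_area_cross cross_coords)

lemma normalized_two_scale:
  fixes Q :: "nat \<Rightarrow> polygon" and c u :: "real^2"
  assumes as: "area_nondegenerate_asymptotic n Q u" and A: "A > 0"
  defines "R \<equiv> \<lambda>k. dilate c (sqrt (A / area n (Q k))) (centroid n (Q k)) (Q k)"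
  shows "(\<lambda>k. infdist (R k i) (range (\<lambda>t. c + t *\<^sub>R u))) \<longlonglongrightarrow> 0"
    and "\<exists>i j. filterlim (\<lambda>k. dist (R k i) (R k j)) at_top sequentially"
proof -
  obtain v \<alpha> \<beta> a b where
    ts: "centered_two_scale_asymptotic_with n Q u v \<alpha> \<beta> a b"
    and B: "oriented_area n (\<lambda>i. a i *\<^sub>R u + b i *\<^sub>R v) \<noteq> 0"
    using as by (auto simp: area_nondegenerate_asymptotic_def)
  have Q: "\<And>k. labeled_polygon n (Q k)" "\<And>k. area n (Q k) \<noteq> 0"
    and uv: "u \<noteq> v" "independent {u, v}"
    and nz: "\<And>k. \<alpha> k \<noteq> 0" "\<And>k. \<beta> k \<noteq> 0"
    and ratio: "(\<lambda>k. \<bar>\<beta> k\<bar> / \<bar>\<alpha> k\<bar>) \<longlonglongrightarrow> 0"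
    using ts by (simp_all add: centered_two_scale_asymptotic_with_def)
  obtain x y where
    xy: "\<And>k i. Q k i - centroid n (Q k) = x k i *\<^sub>R u + y k i *\<^sub>R v"
    and lim: "\<And>i. (\<lambda>k. x k i / \<alpha> k) \<longlonglongrightarrow> a i" "\<And>i. (\<lambda>k. y k i / \<beta> k) \<longlonglongrightarrow> b i"
    using ts unfolding centered_two_scale_asymptotic_with_def by blast
  have cr: "cross u v \<noteq> 0" using uv cross_independent by blast
  then have u0: "u \<noteq> 0" by (auto simp: cross_def)
  \<comment> \<open>The area in rescaled coordinates, which converges to the nonzero
    \<open>D\<close>. Area is bilinear in the two coordinate families, so the scales split off as
    \<open>\<alpha> k * \<beta> k\<close>.\<close>
  define Bk where "Bk k = oriented_area n (\<lambda>i. (x k i / \<alpha> k) *\<^sub>R u + (y k i / \<beta> k) *\<^sub>R v)" for k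
  define D where "D = oriented_area n (\<lambda>i. a i *\<^sub>R u + b i *\<^sub>R v)"
  have Bk_lim: "Bk \<longlonglongrightarrow> D"
    unfolding Bk_def D_def oriented_area_coords by (intro tendsto_intros lim)
  have area: "area n (Q k) = \<bar>\<alpha> k\<bar> * \<bar>\<beta> k\<bar> * \<bar>Bk k\<bar>" for k
  proof -
    \<comment> \<open>With ratio 1, moving the centroid to the origin leaves the area
      unchanged.\<close>
    have "oriented_area n (Q k) = oriented_area n (dilate 0 1 (centroid n (Q k)) (Q k))"
      using oriented_area_dilate[OF Q(1)] by simp
    also have "\<dots> = oriented_area n (\<lambda>i. x k i *\<^sub>R u + y k i *\<^sub>R v)"
      by (simp add: dilate_def xy)
    also have "\<dots> = \<alpha> k * \<beta> k * Bk k"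
    proof -
      have "x k i * y k (i + 1) - y k i * x k (i + 1) =
        \<alpha> k * \<beta> k * (x k i / \<alpha> k * (y k (i + 1) / \<beta> k) - y k i / \<beta> k * (x k (i + 1) / \<alpha> k))" for i
        using nz[of k] by (simp add: field_simps)
      then show ?thesis
        unfolding Bk_def oriented_area_coords by (simp only: sum_distrib_left mult_ac)
    qed
    finally show ?thesis by (simp add: area_def abs_mult)
  qed
  have Bk_nz: "Bk k \<noteq> 0" for k using area[of k] Q(2)[of k] by auto
  define w where "w k = \<bar>\<beta> k\<bar> / \<bar>\<alpha> k\<bar>" for k
  have w_pos: "w k > 0" for k using nz[of k] by (simp add: w_def)
  define T where "T k = sqrt (A / area n (Q k))" for k
  have T_pos: "T k > 0" for k
    using A Q(2)[of k] by (simp add: T_def area_def)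
  \<comment> \<open>Under the root, one factor of the area cancels against the square of
    \<open>\<beta> k\<close> and leaves the ratio \<open>w k\<close>; \<open>T_alpha\<close> yields
    the inverse ratio in the same way.\<close>
  have T_beta: "T k * \<bar>\<beta> k\<bar> = sqrt (A * w k / \<bar>Bk k\<bar>)" for k
  proof -
    have "T k * \<bar>\<beta> k\<bar> = sqrt (A / area n (Q k) * (\<beta> k)\<^sup>2)"
      unfolding T_def real_sqrt_mult by simp
    also have "A / area n (Q k) * (\<beta> k)\<^sup>2 = A * w k / \<bar>Bk k\<bar>"
    proof -
      have sq: "(\<beta> k)\<^sup>2 = \<bar>\<beta> k\<bar> * \<bar>\<beta> k\<bar>" by (simp add: power2_eq_square)
      show ?thesis unfolding sq area w_def using nz[of k] by (simp add: field_simps del: abs_mult_self_eq)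
    qed
    finally show ?thesis .
  qed
  have T_alpha: "T k * \<bar>\<alpha> k\<bar> = sqrt (A / \<bar>Bk k\<bar> * inverse (w k))" for k
  proof -
    have "T k * \<bar>\<alpha> k\<bar> = sqrt (A / area n (Q k) * (\<alpha> k)\<^sup>2)"
      unfolding T_def real_sqrt_mult by simp
    also have "A / area n (Q k) * (\<alpha> k)\<^sup>2 = A / \<bar>Bk k\<bar> * inverse (w k)"
    proof -
      have sq: "(\<alpha> k)\<^sup>2 = \<bar>\<alpha> k\<bar> * \<bar>\<alpha> k\<bar>" by (simp add: power2_eq_square)
      show ?thesis unfolding sq area w_def using nz[of k] by (simp add: field_simps del: abs_mult_self_eq)
    qed
    finally show ?thesis .
  qed
  have Tb0: "(\<lambda>k. T k * \<bar>\<beta> k\<bar>) \<longlonglongrightarrow> 0"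
  proof -
    have "(\<lambda>k. sqrt (A * w k / \<bar>Bk k\<bar>)) \<longlonglongrightarrow> sqrt (A * 0 / \<bar>D\<bar>)"
      using B ratio unfolding w_def D_def[symmetric] by (intro tendsto_intros Bk_lim) auto
    then show ?thesis by (simp add: T_beta)
  qed
  \<comment> \<open>The factor \<open>e\<close> makes one limit serve twice: \<open>e = 0\<close>
    for the distance to the line, \<open>e = 1\<close> for the differences in the diameter
    estimate.\<close>
  have Ty0: "(\<lambda>k. T k * \<bar>y k i - e * y k j\<bar>) \<longlonglongrightarrow> 0" for i j e
  proof -
    have "(\<lambda>k. T k * \<bar>\<beta> k\<bar> * \<bar>y k i / \<beta> k - e * (y k j / \<beta> k)\<bar>) \<longlonglongrightarrow> 0 * \<bar>b i - e * b j\<bar>"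
      by (intro tendsto_intros Tb0 lim)
    moreover have "T k * \<bar>\<beta> k\<bar> * \<bar>y k i / \<beta> k - e * (y k j / \<beta> k)\<bar> = T k * \<bar>y k i - e * y k j\<bar>" for k
    proof -
      have "y k i / \<beta> k - e * (y k j / \<beta> k) = (y k i - e * y k j) / \<beta> k"
        by (simp add: diff_divide_distrib)
      then show ?thesis using nz(2)[of k] by (simp add: abs_divide)
    qed
    ultimately show ?thesis by (simp only: mult_zero_left)
  qed
  have Ta: "filterlim (\<lambda>k. T k * \<bar>\<alpha> k\<bar>) at_top sequentially"
  proof -
    have "filterlim (\<lambda>k. inverse (w k)) at_top sequentially"
      using ratio w_pos unfolding w_def[symmetric]
      by (intro filterlim_inverse_at_top) auto
    moreover have "(\<lambda>k. A / \<bar>Bk k\<bar>) \<longlonglongrightarrow> A / \<bar>D\<bar>"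
      using B unfolding D_def[symmetric] by (intro tendsto_intros Bk_lim) auto
    ultimately have "filterlim (\<lambda>k. A / \<bar>Bk k\<bar> * inverse (w k)) at_top sequentially"
      using A B D_def by (intro filterlim_tendsto_pos_mult_at_top[where c = "A / \<bar>D\<bar>"]) auto
    then show ?thesis
      unfolding T_alpha by (rule filterlim_compose[OF sqrt_at_top])
  qed
  have R: "R k i = c + T k *\<^sub>R (x k i *\<^sub>R u + y k i *\<^sub>R v)" for k i
    by (simp add: R_def dilate_def xy T_def)
  show "(\<lambda>k. infdist (R k i) (range (\<lambda>t. c + t *\<^sub>R u))) \<longlonglongrightarrow> 0"
  proof (rule tendsto_sandwich[where f = "\<lambda>_. 0" and h = "\<lambda>k. T k * \<bar>y k i\<bar> * norm v"])
    have "infdist (R k i) (range (\<lambda>t. c + t *\<^sub>R u)) \<le> T k * \<bar>y k i\<bar> * norm v" for k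
    proof -
      \<comment> \<open>The comparison point on the line is \<open>R k i\<close> without its
        transverse part.\<close>
      have "infdist (R k i) (range (\<lambda>t. c + t *\<^sub>R u)) \<le> dist (R k i) (c + (T k * x k i) *\<^sub>R u)"
        by (rule infdist_le) auto
      also have "\<dots> = norm ((T k * y k i) *\<^sub>R v)"
        by (simp add: dist_norm R algebra_simps)
      finally show ?thesis using T_pos[of k] by (simp add: abs_mult)
    qed
    then show "\<forall>\<^sub>F k in sequentially. infdist (R k i) (range (\<lambda>t. c + t *\<^sub>R u)) \<le> T k * \<bar>y k i\<bar> * norm v"
      by simp
    show "(\<lambda>k. T k * \<bar>y k i\<bar> * norm v) \<longlonglongrightarrow> 0"
      using tendsto_mult_left_zero[OF Ty0[of i 0 i]] by simp
  qed (auto simp: infdist_nonneg)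
  have per: "b (1 + int n) = b 1"
  proof -
    have "y k (1 + int n) = y k 1" for k
    proof -
      have "Q k (1 + int n) = Q k 1" using Q(1)[of k] by (simp add: labeled_polygon_def)
      then have "x k (1 + int n) *\<^sub>R u + y k (1 + int n) *\<^sub>R v = x k 1 *\<^sub>R u + y k 1 *\<^sub>R v"
        by (metis xy)
      \<comment> \<open>Pairing with \<open>u\<close> kills the coordinate along \<open>u\<close>
        and leaves the transverse one times the nonzero \<open>cross u v\<close>.\<close>
      then have "cross (1 *\<^sub>R u + 0 *\<^sub>R v) (x k (1 + int n) *\<^sub>R u + y k (1 + int n) *\<^sub>R v) =
          cross (1 *\<^sub>R u + 0 *\<^sub>R v) (x k 1 *\<^sub>R u + y k 1 *\<^sub>R v)" by simp
      then show ?thesis using cr unfolding cross_coords by simp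
    qed
    then show ?thesis using lim(2)[of "1 + int n"] lim(2)[of 1] LIMSEQ_unique by simp
  qed
  \<comment> \<open>If the \<open>a i\<close> were all equal, the area sum would telescope.\<close>
  have "\<exists>i j. a i \<noteq> a j"
  proof (rule ccontr)
    assume "\<not> ?thesis"
    then have a: "a i = a 0" for i by simp
    have "oriented_area n (\<lambda>i. a i *\<^sub>R u + b i *\<^sub>R v) =
        (1/2) * (\<Sum>i\<in>{1..int n}. a 0 * cross u v * (b (i + 1) - b i))"
      unfolding oriented_area_coords by (subst (1 2) a) (simp add: algebra_simps)
    also have "\<dots> = 0"
      using periodic_sum_Suc[of b, OF per] by (simp add: sum_subtractf flip: sum_distrib_left)
    finally show False using B by simp
  qed
  then obtain i j where ij: "a i \<noteq> a j" by blast
  have "filterlim (\<lambda>k. dist (R k i) (R k j)) at_top sequentially"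
  proof (rule filterlim_at_top_mono)
    \<comment> \<open>The distance is at least the part along \<open>u\<close> minus the transverse
      part. The former diverges because \<open>a i\<close> and \<open>a j\<close> differ, the latter
      tends to zero.\<close>
    let ?X = "\<lambda>k. \<bar>x k i / \<alpha> k - x k j / \<alpha> k\<bar> * norm u * (T k * \<bar>\<alpha> k\<bar>)"
    let ?Y = "\<lambda>k. T k * \<bar>y k i - 1 * y k j\<bar> * norm v"
    have X: "filterlim ?X at_top sequentially"
      using ij u0
      by (intro filterlim_tendsto_pos_mult_at_top[where c = "\<bar>a i - a j\<bar> * norm u"] tendsto_intros lim Ta)
        auto
    have "(\<lambda>k. - ?Y k) \<longlonglongrightarrow> - 0"
      by (intro tendsto_minus tendsto_mult_left_zero Ty0)
    then show "filterlim (\<lambda>k. - ?Y k + ?X k) at_top sequentially"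
      using X by (rule filterlim_tendsto_add_at_top)
    have "- ?Y k + ?X k \<le> dist (R k i) (R k j)" for k
    proof -
      have eq: "R k i - R k j = (T k * (x k i - x k j)) *\<^sub>R u - (T k * (y k j - y k i)) *\<^sub>R v"
        by (simp add: R algebra_simps)
      have "?X k = norm ((T k * (x k i - x k j)) *\<^sub>R u)"
        using T_pos[of k] nz(1)[of k]
        by (simp add: abs_mult flip: diff_divide_distrib)
      moreover have "?Y k = norm ((T k * (y k j - y k i)) *\<^sub>R v)"
        using T_pos[of k] by (simp add: abs_mult abs_minus_commute)
      ultimately show ?thesis
        unfolding dist_norm eq
        using norm_triangle_ineq2[of "(T k * (x k i - x k j)) *\<^sub>R u" "(T k * (y k j - y k i)) *\<^sub>R v"]
        by linarith
    qed
    then show "\<forall>\<^sub>F k in sequentially. - ?Y k + ?X k \<le> dist (R k i) (R k j)" by simp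
  qed
  then show "\<exists>i j. filterlim (\<lambda>k. dist (R k i) (R k j)) at_top sequentially" by blast
qed

section \<open>Limits along residue classes\<close>

text \<open>Finitely many classes have a common threshold \<open>N\<close> for \<open>q\<close>, and
  any \<open>k \<ge> m * N\<close> has quotient at least \<open>N\<close>.\<close>

lemma eventually_residues:
  assumes "m \<ge> 1" and ev: "\<And>r. r < m \<Longrightarrow> \<forall>\<^sub>F q in sequentially. Z (m * q + r)"
  shows "\<forall>\<^sub>F k in sequentially. Z (k :: nat)"
proof -
  have "\<forall>\<^sub>F q in sequentially. \<forall>r\<in>{..<m}. Z (m * q + r)"
    using ev by (subst eventually_ball_finite_distrib) auto
  then obtain N where N: "\<And>q r. q \<ge> N \<Longrightarrow> r < m \<Longrightarrow> Z (m * q + r)"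
    by (auto simp: eventually_sequentially)
  have "Z k" if "k \<ge> m * N" for k
  proof -
    have "k div m \<ge> N" using that assms(1)
      by (metis div_le_mono nonzero_mult_div_cancel_left not_one_le_zero)
    then have "Z (m * (k div m) + k mod m)" using assms(1) by (intro N) auto
    then show ?thesis by (metis mult_div_mod_eq)
  qed
  then show ?thesis by (auto simp: eventually_sequentially)
qed

lemma filterlim_residues:
  assumes "m \<ge> 1" "\<And>r. r < m \<Longrightarrow> filterlim (\<lambda>q. f (m * q + r)) F sequentially"
  shows "filterlim f F sequentially"
  unfolding filterlim_iff
proof (intro allI impI)
  fix Z assume "eventually Z F"
  then have "\<forall>\<^sub>F q in sequentially. Z (f (m * q + r))" if "r < m" for r
    using assms(2)[OF that] unfolding filterlim_iff by blast
  then show "\<forall>\<^sub>F k in sequentially. Z (f k)"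
    by (rule eventually_residues[OF assms(1), where Z = "\<lambda>k. Z (f k)"])
qed

text \<open>A maximum of nonnegative terms is at most their sum, here a finite sum of null
  sequences.\<close>

lemma tendsto_Max_0:
  fixes f :: "nat \<Rightarrow> 'a \<Rightarrow> real"
  assumes "finite I" "I \<noteq> {}" "\<And>i. i \<in> I \<Longrightarrow> (\<lambda>k. f k i) \<longlonglongrightarrow> 0" "\<And>k i. f k i \<ge> 0"
  shows "(\<lambda>k. Max (f k ` I)) \<longlonglongrightarrow> 0"
proof (rule tendsto_sandwich[where f = "\<lambda>_. 0" and h = "\<lambda>k. \<Sum>i\<in>I. f k i"])
  show "(\<lambda>k. \<Sum>i\<in>I. f k i) \<longlonglongrightarrow> 0" using tendsto_sum[of I "\<lambda>i k. f k i" "\<lambda>_. 0"] assms by simp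
  have "Max (f k ` I) \<le> (\<Sum>i\<in>I. f k i)" for k
    using assms by (subst Max_le_iff) (auto intro!: member_le_sum)
  then show "\<forall>\<^sub>F k in sequentially. Max (f k ` I) \<le> (\<Sum>i\<in>I. f k i)" by simp
  have "0 \<le> Max (f k ` I)" for k
    using assms by (subst Max_ge_iff) auto
  then show "\<forall>\<^sub>F k in sequentially. 0 \<le> Max (f k ` I)" by simp
qed auto

section \<open>Relabelling and the flattening of the normalized iterates\<close>

lemma centroid_relabel:
  assumes "labeled_polygon n Q"
  shows "centroid n (relabel s Q) = centroid n Q"
  using periodic_sum_shift[of Q n s] assms
  by (simp add: centroid_def relabel_def labeled_polygon_def)

lemma area_relabel:
  assumes "labeled_polygon n Q"
  shows "area n (relabel s Q) = area n Q"
proof -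
  have "Q (i + int n) = Q i" "Q (i + int n + 1) = Q (i + 1)" for i
    using assms by (metis labeled_polygon_def, metis labeled_polygon_def add.assoc add.commute)
  then show ?thesis
    using periodic_sum_shift[of "\<lambda>i. cross (Q i) (Q (i + 1))" n s]
    by (simp add: area_def oriented_area_cross relabel_def add_ac)
qed

theorem theorem5p7:
  fixes n m :: nat and P :: polygon and G :: "real^3^3" and s :: int
    and l :: "proj_point set" and u :: "real^2"
  assumes "labeled_polygon n P"
    and "area n P > 0"
    and "\<forall>k. pentagram_defined ((pentagram ^^ k) P) \<and> area n ((pentagram ^^ k) P) \<noteq> 0"
    and "m \<ge> 1"
    and "invertible G"
    and "proj_polygon ((pentagram ^^ m) P) = relabel s (proj_map_polygon G (proj_polygon P))"
    and "dominant_real_spectral_line G l"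
    and "finite_affine_direction l u"
    and "\<forall>r<m. area_nondegenerate_asymptotic_under n G ((pentagram ^^ r) P) u"
  defines "L \<equiv> range (\<lambda>t::real. centroid n P + t *\<^sub>R u)"
    and "Pk \<equiv> \<lambda>k. (normalized_pentagram n ^^ k) P"
  shows "(\<forall>k. normalized_pentagram_defined n (Pk k)) \<and>
    (\<lambda>k. Max ((\<lambda>i. infdist (Pk k i) L) ` {1..int n})) \<longlonglongrightarrow> 0 \<and>
    filterlim (\<lambda>k. diameter (Pk k ` {1..int n})) at_top sequentially"
proof (intro conjI allI)
  have n: "n \<ge> 1" using assms(1) by (simp add: labeled_polygon_def)
  show "normalized_pentagram_defined n (Pk k)" for k
    unfolding Pk_def by (rule normalized_pentagram_funpow[OF assms(1-3)])
  \<comment> \<open>Vertex sets are compared, since the maximum and the diameter depend on nothing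
    else. This absorbs the relabelling by \<open>s * int q\<close>, which varies with
    \<open>q\<close>.\<close>
  have "\<exists>Qs. area_nondegenerate_asymptotic n Qs u \<and>
      (\<forall>q. Pk (m * q + r) ` {1..int n} =
        range (dilate (centroid n P) (sqrt (area n P / area n (Qs q))) (centroid n (Qs q)) (Qs q)))"
    if r: "r < m" for r
  proof -
    obtain Qs where Qs: "\<And>k. proj_polygon (Qs k) = (proj_map_polygon G ^^ k) (proj_polygon ((pentagram ^^ r) P))"
      and as: "area_nondegenerate_asymptotic n Qs u"
      using assms(9) r unfolding area_nondegenerate_asymptotic_under_def by blast
    have Qs_lab: "labeled_polygon n (Qs q)" for q
      using as by (auto simp: area_nondegenerate_asymptotic_def centered_two_scale_asymptotic_with_def)
    have "Pk (m * q + r) ` {1..int n} =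
        range (dilate (centroid n P) (sqrt (area n P / area n (Qs q))) (centroid n (Qs q)) (Qs q))"
      (is "_ = range ?R") for q
    proof -
      have "proj_polygon ((pentagram ^^ (m * q + r)) P) = relabel (s * int q) (proj_polygon (Qs q))"
        using funpow_pentagram_projective[OF assms(5) _ assms(6)] assms(3) Qs by simp
      \<comment> \<open>The affine chart is injective, so an equality of projective points descends
        to the plane.\<close>
      then have "(pentagram ^^ (m * q + r)) P = relabel (s * int q) (Qs q)"
        by (auto simp: fun_eq_iff proj_polygon_def relabel_def intro: affine_point_inj)
      then have "Pk (m * q + r) = relabel (s * int q) ?R"
        unfolding Pk_def normalized_pentagram_funpow(1)[OF assms(1-3)]
        by (simp add: area_relabel[OF Qs_lab] centroid_relabel[OF Qs_lab])
          (simp add: dilate_def relabel_def)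
      then have "Pk (m * q + r) ` {1..int n} = (\<lambda>i. ?R (i + s * int q)) ` {1..int n}"
        by (simp only: relabel_def)
      moreover have "?R (i + int n) = ?R i" for i
        using Qs_lab[of q] by (simp add: dilate_def labeled_polygon_def)
      then have "(\<lambda>i. ?R (i + s * int q)) ` {1..int n} = range (\<lambda>i. ?R (i + s * int q))"
        using n by (intro periodic_image) (metis add.assoc add.commute)
      \<comment> \<open>Translation by \<open>s * int q\<close> permutes the integers, so passing
        from the window to the full range removes the shift.\<close>
      moreover have "range (\<lambda>i. ?R (i + s * int q)) = range ?R"
        using surj_plus_right[of "s * int q"] by (metis (mono_tags) image_image)
      ultimately show ?thesis by metis
    qed
    then show ?thesis using as by blast
  qed
  then obtain Qs where as: "\<And>r. r < m \<Longrightarrow> area_nondegenerate_asymptotic n (Qs r) u"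
    and img: "\<And>r q. r < m \<Longrightarrow> Pk (m * q + r) ` {1..int n} =
        range (dilate (centroid n P) (sqrt (area n P / area n (Qs r q))) (centroid n (Qs r q)) (Qs r q))"
    by metis
  define R where "R r q = dilate (centroid n P) (sqrt (area n P / area n (Qs r q))) (centroid n (Qs r q)) (Qs r q)"
    for r q
  have R_img: "Pk (m * q + r) ` {1..int n} = R r q ` {1..int n}" if "r < m" for r q
  proof -
    have "labeled_polygon n (Qs r q)"
      using as[OF that] by (auto simp: area_nondegenerate_asymptotic_def centered_two_scale_asymptotic_with_def)
    then have "R r q ` {1..int n} = range (R r q)"
      using n by (intro periodic_image) (auto simp: R_def dilate_def labeled_polygon_def)
    then show ?thesis using img[OF that] by (simp add: R_def)
  qed
  show "(\<lambda>k. Max ((\<lambda>i. infdist (Pk k i) L) ` {1..int n})) \<longlonglongrightarrow> 0"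
  proof (rule filterlim_residues[OF assms(4)])
    fix r assume r: "r < m"
    have "(\<lambda>q. infdist (R r q i) L) \<longlonglongrightarrow> 0" for i
      unfolding R_def L_def by (rule normalized_two_scale(1)[OF as[OF r] assms(2)])
    then have "(\<lambda>q. Max ((\<lambda>i. infdist (R r q i) L) ` {1..int n})) \<longlonglongrightarrow> 0"
      using n by (intro tendsto_Max_0) (auto simp: infdist_nonneg)
    moreover have "(\<lambda>z. infdist z L) ` R r q ` {1..int n} =
        (\<lambda>z. infdist z L) ` Pk (m * q + r) ` {1..int n}" for q
      by (simp only: R_img[OF r])
    ultimately show "(\<lambda>q. Max ((\<lambda>i. infdist (Pk (m * q + r) i) L) ` {1..int n})) \<longlonglongrightarrow> 0"
      by (simp only: image_image)
  qed
  show "filterlim (\<lambda>k. diameter (Pk k ` {1..int n})) at_top sequentially"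
  proof (rule filterlim_residues[OF assms(4)])
    fix r assume r: "r < m"
    obtain i j where ij: "filterlim (\<lambda>q. dist (R r q i) (R r q j)) at_top sequentially"
      using normalized_two_scale(2)[OF as[OF r] assms(2)] unfolding R_def by blast
    \<comment> \<open>The indices \<open>i\<close> and \<open>j\<close> are arbitrary integers; by
      periodicity both points still belong to the image of the window
      \<open>{1..int n}\<close>.\<close>
    have "dist (R r q i) (R r q j) \<le> diameter (Pk (m * q + r) ` {1..int n})" for q
    proof (rule diameter_bounded_bound)
      show "bounded (Pk (m * q + r) ` {1..int n})" by (simp add: finite_imp_bounded)
    qed (use img[OF r, of q] R_def in auto)
    then show "filterlim (\<lambda>q. diameter (Pk (m * q + r) ` {1..int n})) at_top sequentially"
      by (intro filterlim_at_top_mono[OF ij]) simp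
  qed
qed

end
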